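(* Let $h>0$. Any random variable $X$ in $\mathfrak{F}_h$ is subgaussian, and its Laplace transform $L(t)=\mathbb{E}\,e^{tX}$ is representable as $$L(t)=\Psi(t)\,e^{t^2/2},\qquad t\in\mathbb{R},$$ where the function $\Psi$ is periodic with period $h$. Conversely, if $X$ is a subgaussian random variable for which the function $\Psi(t)=L(t)\,e^{-t^2/2}$, $t\in\mathbb{R}$, is $h$-periodic, and if the characteristic function $f(t)=\mathbb{E}\,e^{itX}$ of $X$ is integrable on $\mathbb{R}$, then $X$ belongs to $\mathfrak{F}_h$.
   Context: $\varphi(x)=\frac{1}{\sqrt{2\pi}}e^{-x^2/2}$ is the standard normal density. For $h>0$, $\mathfrak{F}_h$ is the class of all random variables $X$ having a density $p(x)$ such that $q(x)=p(x)/\varphi(x)$, $x\in\mathbb{R}$, is periodic with period $h$, i.e. $q(x+h)=q(x)$ for all $x\in\mathbb{R}$. A random variable $X$ is called subgaussian if $\mathbb{E}\,e^{cX^2}<\infty$ for some constant $c>0$. *)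

theory Defs
  imports "HOL-Probability.Probability" "HOL-Library.Periodic_Fun"
begin

text \<open>
  As usual, a density is determined only up to null sets: membership means that some version
  \<open>p\<close> of the density has \<open>p / \<phi>\<close> periodic at every point of the real line. No minimality
  of the period \<open>h\<close> is required; \<^const>\<open>periodic_fun_simple\<close> \<open>q h\<close> unfolds to
  \<open>\<forall>x. q (x + h) = q x\<close>.
\<close>

definition periodic_class :: "real \<Rightarrow> 'a measure \<Rightarrow> ('a \<Rightarrow> real) set" where
  "periodic_class h M = {X. \<exists>p :: real \<Rightarrow> real. (\<forall>x. 0 \<le> p x) \<and>
     distributed M lborel X (\<lambda>x. ennreal (p x)) \<and>
     periodic_fun_simple (\<lambda>x. p x / std_normal_density x) h}"

definition subgaussian :: "'a measure \<Rightarrow> ('a \<Rightarrow> real) \<Rightarrow> bool" where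
  "subgaussian M X \<longleftrightarrow>
     X \<in> borel_measurable M \<and> (\<exists>c>0. integrable M (\<lambda>\<omega>. exp (c * (X \<omega>)\<^sup>2)))"

text \<open>
  The Bochner integral below is 0 where the expectation is infinite; by
  \<open>subgaussian_integrable_exp\<close> this does not occur for subgaussian variables.
\<close>

definition laplace_transform :: "'a measure \<Rightarrow> ('a \<Rightarrow> real) \<Rightarrow> real \<Rightarrow> real" where
  "laplace_transform M X t = (\<integral>\<omega>. exp (t * X \<omega>) \<partial>M)"

lemma subgaussian_integrable_exp:
  assumes "subgaussian M X"
  shows "integrable M (\<lambda>\<omega>. exp (t * X \<omega>))"
proof -
  obtain c where [measurable]: "X \<in> borel_measurable M" and c: "c > 0"
    and int: "integrable M (\<lambda>\<omega>. exp (c * (X \<omega>)\<^sup>2))"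
    using assms by (auto simp: subgaussian_def)
  have bound: "exp (t * x) \<le> exp (t\<^sup>2 / (4 * c)) * exp (c * x\<^sup>2)" for x :: real
  proof -
    have "t\<^sup>2 / (4 * c) + c * x\<^sup>2 - t * x = (t - 2 * c * x)\<^sup>2 / (4 * c)"
      using c by (simp add: field_simps power2_eq_square)
    also have "\<dots> \<ge> 0"
      using c by simp
    finally show ?thesis
      by (simp flip: exp_add)
  qed
  show ?thesis
  proof (rule Bochner_Integration.integrable_bound)
    show "integrable M (\<lambda>\<omega>. exp (t\<^sup>2 / (4 * c)) * exp (c * (X \<omega>)\<^sup>2))"
      using int by simp
  qed (use bound in auto)
qed

end

theory Submission
  imports Defs "HOL-Complex_Analysis.Cauchy_Integral_Formula"
begin

text \<open>
  For a density \<open>p = q \<phi>\<close>, completing the square shows that \<open>\<Psi>(t) = L(t) exp(- t\<^sup>2 / 2)\<close> is the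
  Gaussian average \<open>\<integral> q(x) \<phi>(x - t) dx\<close>. If \<open>q\<close> has period \<open>h\<close>, so has \<open>\<Psi>\<close>; being bounded on one
  period it is bounded everywhere (\<open>periodic_class_mgf_factorization\<close>), and a bound
  \<open>L(t) \<le> B exp(t\<^sup>2 / 2)\<close> forces subgaussianity by integrating \<open>L\<close> against a Gaussian weight
  (\<open>subgaussian_if_mgf_bound\<close>).

  For the converse, periodicity of \<open>\<Psi>\<close> is an identity between two moment generating functions:
  tilting the law \<open>\<mu>\<close> of \<open>X\<close> by \<open>exp(h x - h\<^sup>2 / 2)\<close> has the same effect as translating it by \<open>h\<close>.
  Subgaussianity makes these functions entire, so they determine the laws (\<open>mgf_uniqueness\<close>), and
  the two measures coincide. This replaces the shift of a contour in the Fourier inversion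
  integral. An integrable characteristic function yields a continuous density \<open>p\<close>
  (\<open>obtain_continuous_density\<close>), and continuity upgrades the almost everywhere identity
  \<open>p(x) exp(h x - h\<^sup>2 / 2) = p(x - h)\<close> to all points. Since
  \<open>\<phi>(x) exp(h x - h\<^sup>2 / 2) = \<phi>(x - h)\<close>, the quotient \<open>p / \<phi>\<close> has period \<open>h\<close>.
\<close>

section \<open>Gaussian averages and the direct part\<close>

lemma nn_integral_normal_density:
  assumes "\<sigma> > 0"
  shows "(\<integral>\<^sup>+x. ennreal (normal_density \<mu> \<sigma> x) \<partial>lborel) = 1"
  using assms by (simp add: nn_integral_eq_integral)

text \<open>
  Completing the square: exponential tilting of the Gaussian weight is translation. In both
  halves of the theorem this converts between periodicity of \<open>p / \<phi>\<close> and periodicity of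
  \<open>L(t) exp(- t\<^sup>2 / 2)\<close>.
\<close>

lemma std_normal_density_tilt:
  "exp (t * x) * std_normal_density x = exp (t\<^sup>2 / 2) * std_normal_density (x - t)"
  by (simp add: std_normal_density_def power2_eq_square field_simps flip: exp_add)

lemma nn_integral_exp_std_normal_density:
  "(\<integral>\<^sup>+t. ennreal (exp (a * t) * std_normal_density t) \<partial>lborel) = ennreal (exp (a\<^sup>2 / 2))"
proof -
  have "(\<integral>\<^sup>+t. ennreal (exp (a * t) * std_normal_density t) \<partial>lborel)
      = (\<integral>\<^sup>+t. ennreal (exp (a\<^sup>2 / 2)) * ennreal (normal_density a 1 t) \<partial>lborel)"
    unfolding std_normal_density_tilt
    by (intro nn_integral_cong) (simp add: normal_density_def flip: ennreal_mult)
  also have "\<dots> = ennreal (exp (a\<^sup>2 / 2))"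
    by (subst nn_integral_cmult) (simp_all add: nn_integral_normal_density)
  finally show ?thesis .
qed

text \<open>
  The square in the exponent is linearised by an independent Gaussian: for a standard normal
  variable \<open>Z\<close>, \<open>exp(x\<^sup>2 / 4) = E exp(x Z / \<surd>2)\<close>. Tonelli then turns \<open>E exp(X\<^sup>2 / 4)\<close> into an
  average of the moment generating function of \<open>X\<close> at \<open>Z / \<surd>2\<close>, and the assumed bound
  \<open>B exp(Z\<^sup>2 / 4)\<close> is integrable against the normal density. Any constant below \<open>1/2\<close> in place
  of \<open>1/4\<close> would serve.
\<close>

lemma subgaussian_if_mgf_bound:
  assumes "prob_space M" and [measurable]: "X \<in> borel_measurable M"
    and bound: "\<And>t. (\<integral>\<^sup>+\<omega>. ennreal (exp (t * X \<omega>)) \<partial>M) \<le> ennreal (B * exp (t\<^sup>2 / 2))"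
  shows "subgaussian M X"
proof -
  interpret prob_space M by fact
  interpret pair_sigma_finite M lborel ..
  have linear: "ennreal (exp (1/4 * x\<^sup>2)) =
      (\<integral>\<^sup>+t. ennreal (exp (t / sqrt 2 * x)) * ennreal (std_normal_density t) \<partial>lborel)" for x :: real
    using nn_integral_exp_std_normal_density[of "x / sqrt 2"]
    by (simp add: power_divide ennreal_mult field_simps)
  \<comment> \<open>\<open>exp(t\<^sup>2 / 4)\<close> only widens the standard normal density to standard deviation \<open>\<surd>2\<close>\<close>
  have weight: "exp ((t / sqrt 2)\<^sup>2 / 2) * std_normal_density t = sqrt 2 * normal_density 0 (sqrt 2) t"
    for t :: real
    by (simp add: normal_density_def real_sqrt_mult power_divide field_simps flip: exp_add)
  have "(\<integral>\<^sup>+\<omega>. ennreal (exp (1/4 * (X \<omega>)\<^sup>2)) \<partial>M)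
      = (\<integral>\<^sup>+\<omega>. (\<integral>\<^sup>+t. ennreal (exp (t / sqrt 2 * X \<omega>)) * ennreal (std_normal_density t) \<partial>lborel) \<partial>M)"
    unfolding linear ..
  also have "\<dots> = (\<integral>\<^sup>+t. (\<integral>\<^sup>+\<omega>. ennreal (exp (t / sqrt 2 * X \<omega>)) * ennreal (std_normal_density t) \<partial>M) \<partial>lborel)"
    by (rule Fubini'[symmetric]) measurable
  also have "\<dots> = (\<integral>\<^sup>+t. (\<integral>\<^sup>+\<omega>. ennreal (exp (t / sqrt 2 * X \<omega>)) \<partial>M) * ennreal (std_normal_density t) \<partial>lborel)"
    by (intro nn_integral_cong nn_integral_multc) measurable
  also have "\<dots> \<le> (\<integral>\<^sup>+t. ennreal (B * exp ((t / sqrt 2)\<^sup>2 / 2)) * ennreal (std_normal_density t) \<partial>lborel)"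
    by (intro nn_integral_mono mult_right_mono bound) simp
  also have "\<dots> = (\<integral>\<^sup>+t. ennreal (B * sqrt 2) * ennreal (normal_density 0 (sqrt 2) t) \<partial>lborel)"
    by (intro nn_integral_cong) (simp add: weight mult.assoc flip: ennreal_mult'')
  also have "\<dots> = ennreal (B * sqrt 2)"
    by (subst nn_integral_cmult) (simp_all add: nn_integral_normal_density)
  also have "\<dots> < \<infinity>"
    by simp
  finally have "integrable M (\<lambda>\<omega>. exp (1/4 * (X \<omega>)\<^sup>2))"
    by (intro integrableI_bounded) auto
  then show ?thesis
    unfolding subgaussian_def by (intro conjI exI[of _ "1/4"]) auto
qed

text \<open>
  Writing the density as \<open>q \<phi>\<close> with \<open>q\<close> periodic, the tilting identity gives
  \<open>E exp(t X) = exp(t\<^sup>2 / 2) \<Psi> t\<close> where \<open>\<Psi> t = \<integral> q(x) \<phi>(x - t) dx\<close>. A shift of \<open>t\<close> by \<open>h\<close> is absorbed by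
  the substitution \<open>x \<mapsto> x + h\<close>, so \<open>\<Psi>\<close> is periodic. Everything is stated in the extended
  nonnegative reals because finiteness is part of the claim: on one period
  \<open>E exp(s X) \<le> E (1 + exp(h X)) = 1 + exp(h\<^sup>2 / 2)\<close>, where \<open>\<Psi> h = \<Psi> 0 = 1\<close> was used, and
  periodicity spreads this bound over the whole line.
\<close>

lemma periodic_class_mgf_factorization:
  assumes "h > 0" and "prob_space M" and "X \<in> periodic_class h M"
  obtains \<Psi> :: "real \<Rightarrow> ennreal" and B :: real
  where "\<And>t. \<Psi> (t + h) = \<Psi> t"
    and "\<And>t. (\<integral>\<^sup>+\<omega>. ennreal (exp (t * X \<omega>)) \<partial>M) = ennreal (exp (t\<^sup>2 / 2)) * \<Psi> t"
    and "\<And>t. \<Psi> t \<le> ennreal B"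
proof -
  interpret prob_space M by fact
  obtain p :: "real \<Rightarrow> real" where p_nonneg: "\<And>x. 0 \<le> p x"
    and dens: "distributed M lborel X (\<lambda>x. ennreal (p x))"
    and "periodic_fun_simple (\<lambda>x. p x / std_normal_density x) h"
    using assms(3) by (auto simp: periodic_class_def)
  interpret q: periodic_fun_simple "\<lambda>x. p x / std_normal_density x" h by fact
  define q where "q x = p x / std_normal_density x" for x
  have q_nonneg: "0 \<le> q x" and p_eq: "p x = q x * std_normal_density x" for x
    using p_nonneg normal_density_pos[of 1 0 x] by (simp_all add: q_def)
  have q_shift: "q (x + h) = q x" for x
    by (simp add: q_def q.plus_period)
  have [measurable]: "p \<in> borel_measurable borel"
    using distributed_borel_measurable[OF dens] p_nonneg by simp
  have [measurable]: "q \<in> borel_measurable borel"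
    unfolding q_def[abs_def] by measurable
  define L \<Psi> where "L t = (\<integral>\<^sup>+\<omega>. ennreal (exp (t * X \<omega>)) \<partial>M)"
    and "\<Psi> t = (\<integral>\<^sup>+x. ennreal (q x * std_normal_density (x - t)) \<partial>lborel)" for t
  have L_eq: "L t = ennreal (exp (t\<^sup>2 / 2)) * \<Psi> t" for t
  proof -
    have "L t = (\<integral>\<^sup>+x. ennreal (p x) * ennreal (exp (t * x)) \<partial>lborel)"
      unfolding L_def by (rule distributed_nn_integral[OF dens, symmetric]) measurable
    also have "\<dots> = (\<integral>\<^sup>+x. ennreal (exp (t\<^sup>2 / 2)) * ennreal (q x * std_normal_density (x - t)) \<partial>lborel)"
    proof (intro nn_integral_cong)
      fix x
      have "p x * exp (t * x) = exp (t\<^sup>2 / 2) * (q x * std_normal_density (x - t))"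
        using std_normal_density_tilt[of t x] by (simp add: p_eq mult_ac)
      then show "ennreal (p x) * ennreal (exp (t * x)) =
          ennreal (exp (t\<^sup>2 / 2)) * ennreal (q x * std_normal_density (x - t))"
        using p_nonneg q_nonneg by (simp flip: ennreal_mult)
    qed
    also have "\<dots> = ennreal (exp (t\<^sup>2 / 2)) * \<Psi> t"
      unfolding \<Psi>_def by (rule nn_integral_cmult) measurable
    finally show ?thesis .
  qed
  have \<Psi>_shift: "\<Psi> (t + h) = \<Psi> t" for t
  proof -
    have "\<Psi> (t + h) = (\<integral>\<^sup>+x. ennreal (q (h + x) * std_normal_density (h + x - (t + h))) \<partial>lborel)"
      unfolding \<Psi>_def by (subst nn_integral_real_affine[of _ 1 h]) simp_all
    also have "\<dots> = \<Psi> t"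
      unfolding \<Psi>_def using q_shift by (simp add: add.commute)
    finally show ?thesis .
  qed
  then interpret \<Psi>: periodic_fun_simple \<Psi> h by unfold_locales
  have L_0: "L 0 = 1"
    by (simp add: L_def emeasure_space_1)
  then have \<Psi>_0: "\<Psi> 0 = 1"
    using L_eq[of 0] by simp
  have L_h: "L h = ennreal (exp (h\<^sup>2 / 2))"
    using L_eq[of h] \<Psi>_shift[of 0] \<Psi>_0 by simp
  have [measurable]: "X \<in> borel_measurable M"
    using distributed_measurable[OF dens] by simp
  have \<Psi>_bound: "\<Psi> t \<le> ennreal (1 + exp (h\<^sup>2 / 2))" for t
  proof -
    \<comment> \<open>the representative of \<open>t\<close> modulo \<open>h\<close> in \<open>[0, h)\<close>\<close>
    define s where "s = t - of_int \<lfloor>t / h\<rfloor> * h"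
    have "of_int \<lfloor>t / h\<rfloor> * h \<le> t" "t < (of_int \<lfloor>t / h\<rfloor> + 1) * h"
      using \<open>h > 0\<close> by (simp_all flip: pos_le_divide_eq pos_divide_less_eq)
    then have s: "0 \<le> s" "s \<le> h"
      by (simp_all add: s_def algebra_simps)
    have exp_le: "exp (s * x) \<le> exp (0 * x) + exp (h * x)" for x :: real
    proof (cases "x \<ge> 0")
      case True
      then have "s * x \<le> h * x" using s by (simp add: mult_right_mono)
      then have "exp (s * x) \<le> exp (h * x)" by simp
      then show ?thesis by (simp add: add_increasing)
    next
      case False
      then have "s * x \<le> 0" using s by (simp add: mult_nonneg_nonpos)
      then show ?thesis by (simp add: add_increasing2)
    qed
    have "\<Psi> t = \<Psi> s"
      unfolding s_def by (rule \<Psi>.minus_of_int[symmetric])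
    also have "\<dots> \<le> L s"
      unfolding L_eq using mult_right_mono[of 1 "ennreal (exp (s\<^sup>2 / 2))" "\<Psi> s"]
      by (simp add: ennreal_ge_1)
    also have "\<dots> \<le> (\<integral>\<^sup>+\<omega>. ennreal (exp (0 * X \<omega>)) + ennreal (exp (h * X \<omega>)) \<partial>M)"
      unfolding L_def
      by (intro nn_integral_mono) (use exp_le in \<open>simp only: ennreal_leI exp_ge_zero flip: ennreal_plus\<close>)
    also have "\<dots> = L 0 + L h"
      unfolding L_def by (rule nn_integral_add) measurable
    also have "\<dots> = ennreal (1 + exp (h\<^sup>2 / 2))"
      by (simp add: L_0 L_h ennreal_plus flip: ennreal_1)
    finally show ?thesis .
  qed
  show thesis
    using \<Psi>_shift L_eq[unfolded L_def] \<Psi>_bound by (rule that[of \<Psi> "1 + exp (h\<^sup>2 / 2)"])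
qed

lemma periodic_class_imp_subgaussian:
  assumes "h > 0" and "prob_space M" and "X \<in> borel_measurable M" and "X \<in> periodic_class h M"
  shows "subgaussian M X"
    and "\<exists>\<Psi> :: real \<Rightarrow> real. periodic_fun_simple \<Psi> h \<and>
           (\<forall>t. laplace_transform M X t = \<Psi> t * exp (t\<^sup>2 / 2))"
proof -
  obtain \<Psi> :: "real \<Rightarrow> ennreal" and B :: real
    where shift: "\<And>t. \<Psi> (t + h) = \<Psi> t"
      and mgf: "\<And>t. (\<integral>\<^sup>+\<omega>. ennreal (exp (t * X \<omega>)) \<partial>M) = ennreal (exp (t\<^sup>2 / 2)) * \<Psi> t"
      and bound: "\<And>t. \<Psi> t \<le> ennreal B"
    using periodic_class_mgf_factorization[OF assms(1,2,4)] by metis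
  have "(\<integral>\<^sup>+\<omega>. ennreal (exp (t * X \<omega>)) \<partial>M) \<le> ennreal (B * exp (t\<^sup>2 / 2))" for t
    using mult_left_mono[OF bound, of "ennreal (exp (t\<^sup>2 / 2))" t]
    by (simp add: mgf ennreal_mult'' mult.commute)
  then show "subgaussian M X"
    using assms(2,3) by (rule subgaussian_if_mgf_bound[rotated 2])
  have "laplace_transform M X t = enn2real (\<Psi> t) * exp (t\<^sup>2 / 2)" for t
    using assms(3) unfolding laplace_transform_def
    by (subst integral_eq_nn_integral) (simp_all add: mgf enn2real_mult)
  then show "\<exists>\<Psi> :: real \<Rightarrow> real. periodic_fun_simple \<Psi> h \<and>
           (\<forall>t. laplace_transform M X t = \<Psi> t * exp (t\<^sup>2 / 2))"
    using shift by (intro exI[of _ "\<lambda>t. enn2real (\<Psi> t)"]) (simp add: periodic_fun_simple_def)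
qed

section \<open>Moment generating functions determine laws\<close>

lemma powser_eq_0_imp_coeff_eq_0:
  fixes a :: "nat \<Rightarrow> real"
  assumes "\<And>x. (\<lambda>n. a n * x ^ n) sums 0"
  shows "a n = 0"
proof (rule ccontr)
  assume nz: "a n \<noteq> 0"
  have "a 0 = 0"
    using assms[of 0] by simp
  with nz have "n > 0"
    by (cases n) auto
  have "(\<lambda>n. a n * (x - 0) ^ n) sums 0" for x
    using assms by simp
  then obtain s :: real where "0 < s" and "\<And>z :: real. z \<in> cball 0 s - {0} \<Longrightarrow> (0 :: real) \<noteq> 0"
    using powser_0_nonzero[of 1 0 a "\<lambda>_. 0" n] nz \<open>n > 0\<close> by auto
  from this(2)[of s] \<open>0 < s\<close> show False by simp
qed

text \<open>
  Dominated convergence for the exponential series, with dominating function \<open>exp(\<bar>z\<bar> \<bar>x\<bar>)\<close>. The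
  complex argument matters: real \<open>z\<close> yields the moment generating function and imaginary \<open>z\<close> the
  characteristic function, from the same coefficients.
\<close>

lemma (in real_distribution) mgf_sums_moments:
  fixes z :: complex
  assumes int: "\<And>t. integrable M (\<lambda>x. exp (t * x))"
  shows "(\<lambda>n. complex_of_real ((\<integral>x. x ^ n \<partial>M) / fact n) * z ^ n) sums
           (CLINT x|M. exp (z * x))"
proof -
  have dom: "integrable M (\<lambda>x. exp (r * \<bar>x\<bar>))" for r :: real
  proof (rule Bochner_Integration.integrable_bound)
    show "integrable M (\<lambda>x. exp (r * x) + exp (- r * x))"
      using int[of r] int[of "- r"] by simp
    have "exp (r * \<bar>x\<bar>) \<le> exp (r * x) + exp (- r * x)" for x :: real
      by (cases "x \<ge> 0") (simp_all add: add_increasing add_increasing2)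
    then show "AE x in M. norm (exp (r * \<bar>x\<bar>)) \<le> norm (exp (r * x) + exp (- r * x))"
      by (intro AE_I2) (simp add: abs_of_pos[OF add_pos_pos])
  qed measurable
  have moment: "integrable M (\<lambda>x. x ^ n)" for n
  proof (rule Bochner_Integration.integrable_bound)
    show "integrable M (\<lambda>x. fact n * exp (1 * \<bar>x\<bar>))"
      using dom[of 1] by simp
    have "\<bar>x\<bar> ^ n / fact n \<le> exp \<bar>x\<bar>" for x :: real
      using sum_le_suminf[OF summable_exp_generic[of "\<bar>x\<bar>"], of "{n}"]
      by (simp add: exp_def divide_inverse mult.commute)
    then show "AE x in M. norm (x ^ n) \<le> norm (fact n * exp (1 * \<bar>x\<bar>))"
      by (simp add: power_abs field_simps)
  qed measurable
  define s where "s N x = (\<Sum>n<N. (z * complex_of_real x) ^ n /\<^sub>R fact n)" for N x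
  have "(\<lambda>N. CLINT x|M. s N x) \<longlonglongrightarrow> (CLINT x|M. exp (z * x))"
  proof (rule integral_dominated_convergence)
    show "integrable M (\<lambda>x. exp (norm z * \<bar>x\<bar>))"
      by (rule dom)
    show "AE x in M. (\<lambda>N. s N x) \<longlonglongrightarrow> exp (z * x)"
      unfolding s_def using exp_converges by (auto simp: sums_def)
    show "AE x in M. norm (s N x) \<le> exp (norm z * \<bar>x\<bar>)" for N
    proof (rule AE_I2)
      fix x :: real
      have "norm (s N x) \<le> (\<Sum>n<N. (norm z * \<bar>x\<bar>) ^ n /\<^sub>R fact n)"
        unfolding s_def by (intro sum_norm_le) (simp add: norm_power norm_mult)
      also have "\<dots> \<le> exp (norm z * \<bar>x\<bar>)"
        unfolding exp_def by (intro sum_le_suminf summable_exp_generic) auto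
      finally show "norm (s N x) \<le> exp (norm z * \<bar>x\<bar>)" .
    qed
  qed (unfold s_def, measurable)
  moreover have "(CLINT x|M. s N x) = (\<Sum>n<N. complex_of_real ((\<integral>x. x ^ n \<partial>M) / fact n) * z ^ n)" for N
  proof -
    have term_eq: "(z * complex_of_real x) ^ n /\<^sub>R fact n = (z ^ n / fact n) * complex_of_real (x ^ n)" for x n
      by (simp add: scaleR_conv_of_real power_mult_distrib field_simps)
    have "(CLINT x|M. s N x) = (\<Sum>n<N. CLINT x|M. (z ^ n / fact n) * complex_of_real (x ^ n))"
      unfolding s_def term_eq
      by (intro Bochner_Integration.integral_sum integrable_mult_right integrable_of_real moment)
    also have "\<dots> = (\<Sum>n<N. (z ^ n / fact n) * complex_of_real (\<integral>x. x ^ n \<partial>M))"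
      by (intro sum.cong refl) (simp only: integral_mult_right_zero integral_complex_of_real)
    finally show ?thesis
      by (simp add: field_simps)
  qed
  ultimately show ?thesis
    by (simp add: sums_def)
qed

text \<open>
  An everywhere finite moment generating function is an entire power series whose coefficients
  are the moments, so it determines them; the moments determine the characteristic function
  through the same series at \<open>\<i> t\<close>, and Levy's theorem applies.
\<close>

lemma mgf_uniqueness:
  fixes M N :: "real measure"
  assumes "real_distribution M" and "real_distribution N"
    and int_M: "\<And>t. integrable M (\<lambda>x. exp (t * x))"
    and int_N: "\<And>t. integrable N (\<lambda>x. exp (t * x))"
    and eq: "\<And>t. (\<integral>x. exp (t * x) \<partial>M) = (\<integral>x. exp (t * x) \<partial>N)"
  shows "M = N"
proof (rule Levy_uniqueness)
  interpret M: real_distribution M by fact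
  interpret N: real_distribution N by fact
  let ?c = "\<lambda>L n. (\<integral>x. x ^ n \<partial>L) / fact n :: real"
  have real_sums: "(\<lambda>n. ?c L n * t ^ n) sums (\<integral>x. exp (t * x) \<partial>L)"
    if "real_distribution L" "\<And>t. integrable L (\<lambda>x. exp (t * x))" for L t
  proof -
    interpret L: real_distribution L by fact
    have "(CLINT x|L. exp (complex_of_real t * x)) = complex_of_real (\<integral>x. exp (t * x) \<partial>L)"
      by (simp add: exp_of_real flip: of_real_mult integral_complex_of_real)
    then have "(\<lambda>n. complex_of_real (?c L n * t ^ n)) sums complex_of_real (\<integral>x. exp (t * x) \<partial>L)"
      using L.mgf_sums_moments[OF that(2), of "complex_of_real t"] by simp
    then show ?thesis by (simp only: sums_of_real_iff)
  qed
  have "(\<lambda>n. (?c M n - ?c N n) * t ^ n) sums 0" for t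
    using sums_diff[OF real_sums[OF assms(1) int_M, of t] real_sums[OF assms(2) int_N, of t]]
    by (simp only: eq diff_self left_diff_distrib)
  then have "?c M n - ?c N n = 0" for n
    by (rule powser_eq_0_imp_coeff_eq_0)
  then have coeffs: "?c M n = ?c N n" for n
    by (simp only: right_minus_eq)
  show "char M = char N"
  proof
    fix t :: real
    have "(CLINT x|M. exp (\<i> * t * x)) = (CLINT x|N. exp (\<i> * t * x))"
      using M.mgf_sums_moments[OF int_M, of "\<i> * t"] N.mgf_sums_moments[OF int_N, of "\<i> * t"]
      unfolding coeffs by (rule sums_unique2)
    then show "char M t = char N t"
      by (simp add: char_def mult.assoc)
  qed
qed fact+

section \<open>Continuous densities from integrable characteristic functions\<close>

text \<open>
  The inverse Fourier transform of the characteristic function, kept complex-valued so that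
  Fubini's theorem applies directly; the density will be its real part.
\<close>

definition inv_char :: "real measure \<Rightarrow> real \<Rightarrow> complex" where
  "inv_char M x = (CLINT t|lborel. iexp (- (t * x)) * char M t) / (2 * pi)"

lemma integral_iexp_Ioc:
  fixes a b t :: real
  assumes "a \<le> b" and "t \<noteq> 0"
  shows "(CLINT x:{a<..b}|lborel. iexp (- (t * x))) = (iexp (- (t * a)) - iexp (- (t * b))) / (\<i> * t)"
proof -
  have "(CLINT x:{a<..b}|lborel. iexp (- (t * x))) = (CLBINT x=a..b. iexp (- (t * x)))"
    using assms by (simp add: interval_integral_Ioc)
  also have "\<dots> = (\<lambda>x. \<i> / t * iexp (- (t * x))) b - (\<lambda>x. \<i> / t * iexp (- (t * x))) a"
  proof (rule interval_integral_FTC_finite)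
    show "continuous_on {min a b..max a b} (\<lambda>x. iexp (- (t * x)))"
      by (intro continuous_intros)
    show "((\<lambda>x. \<i> / t * iexp (- (t * x))) has_vector_derivative iexp (- (t * x)))
            (at x within {min a b..max a b})" for x
      using assms(2)
      by (auto intro!: derivative_eq_intros simp: has_vector_derivative_complex_iff Re_exp Im_exp field_simps)
  qed
  also have "\<dots> = (iexp (- (t * a)) - iexp (- (t * b))) / (\<i> * t)"
    using assms(2) by (simp only: divide_divide_eq_left[symmetric] divide_i) (simp add: field_simps)
  finally show ?thesis .
qed

text \<open>
  For an integrable characteristic function the truncated integrals in Levy's inversion formula
  converge absolutely, since the kernel is bounded by \<open>b - a\<close>; hence the limit may be taken
  inside.
\<close>

lemma (in real_distribution) Levy_Inversion_integrable:
  fixes a b :: real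
  assumes "a \<le> b" and "measure M {a} = 0" and "measure M {b} = 0"
    and int: "integrable lborel (char M)"
  shows "complex_of_real (measure M {a<..b}) =
    (CLINT t|lborel. (iexp (- (t * a)) - iexp (- (t * b))) / (\<i> * t) * char M t) / (2 * pi)"
proof -
  define F where "F t = (iexp (- (t * a)) - iexp (- (t * b))) / (\<i> * complex_of_real t)" for t :: real
  have [measurable]: "F \<in> borel_measurable borel"
    unfolding F_def[abs_def] by measurable
  have F_bound: "norm (F t) \<le> b - a" for t
  proof (cases "t = 0")
    case False
    then show ?thesis
      using Levy_Inversion_aux2[of "- b" "- a" t] assms(1) by (simp add: F_def)
  qed (use assms(1) in \<open>simp add: F_def\<close>)
  have "(\<lambda>T::nat. CLINT t|lborel. indicator {- real T<..<real T} t *\<^sub>R (F t * char M t))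
      \<longlonglongrightarrow> (CLINT t|lborel. F t * char M t)"
  proof (rule integral_dominated_convergence)
    show "integrable lborel (\<lambda>t. (b - a) * norm (char M t))"
      using int by simp
    show "AE t in lborel. norm (indicator {- real T<..<real T} t *\<^sub>R (F t * char M t))
            \<le> (b - a) * norm (char M t)" for T
      using F_bound assms(1)
      by (intro AE_I2) (auto simp: norm_mult indicator_def intro!: mult_right_mono)
    show "AE t in lborel. (\<lambda>T. indicator {- real T<..<real T} t *\<^sub>R (F t * char M t))
            \<longlonglongrightarrow> F t * char M t"
    proof (rule AE_I2)
      fix t :: real
      obtain N where "\<bar>t\<bar> < real N"
        using reals_Archimedean2 by blast
      then have "\<forall>T\<ge>N. t \<in> {- real T<..<real T}"
        by auto
      then have "\<forall>\<^sub>F T in sequentially. indicator {- real T<..<real T} t *\<^sub>R (F t * char M t) = F t * char M t"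
        by (auto simp: eventually_sequentially intro!: exI[of _ N])
      then show "(\<lambda>T. indicator {- real T<..<real T} t *\<^sub>R (F t * char M t)) \<longlonglongrightarrow> F t * char M t"
        by (rule tendsto_eventually)
    qed
  qed measurable
  then have "(\<lambda>T::nat. 1 / (2 * pi) * (CLBINT t=- real T..real T. F t * char M t))
      \<longlonglongrightarrow> 1 / (2 * pi) * (CLINT t|lborel. F t * char M t)"
    by (intro tendsto_mult_left)
       (simp add: interval_lebesgue_integral_def set_lebesgue_integral_def)
  moreover have "(\<lambda>T::nat. 1 / (2 * pi) * (CLBINT t=- real T..real T. F t * char M t))
      \<longlonglongrightarrow> complex_of_real (measure M {a<..b})"
    using Levy_Inversion[OF assms(1-3)] by (simp add: F_def)
  ultimately show ?thesis
    using LIMSEQ_unique by (fastforce simp: F_def)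
qed

text \<open>
  The inversion kernel is itself the integral of \<open>exp(- \<i> t x)\<close> over \<open>(a, b]\<close>; exchanging the
  two integrals exhibits the inverse Fourier transform as a density.
\<close>

lemma (in real_distribution) measure_Ioc_if_null_endpoints:
  fixes a b :: real
  assumes "a \<le> b" and "measure M {a} = 0" and "measure M {b} = 0"
    and int: "integrable lborel (char M)"
  shows "complex_of_real (measure M {a<..b}) = (CLINT x:{a<..b}|lborel. inv_char M x)"
proof -
  let ?g = "\<lambda>(t, x). indicator {a<..b} x *\<^sub>R (iexp (- (t * x)) * char M t)"
  have g: "integrable (lborel \<Otimes>\<^sub>M lborel) ?g"
  proof (rule lborel_pair.Fubini_integrable)
    have "(LINT x|lborel. norm (?g (t, x))) = (b - a) * norm (char M t)" for t
    proof -
      have "(LINT x|lborel. norm (?g (t, x))) = (LINT x|lborel. indicator {a<..b} x * norm (char M t))"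
        by (simp add: norm_mult)
      then show ?thesis using assms(1) by simp
    qed
    then show "integrable lborel (\<lambda>t. LINT x|lborel. norm (?g (t, x)))"
      using int by simp
    show "AE t in lborel. integrable lborel (\<lambda>x. ?g (t, x))"
    proof (rule AE_I2)
      fix t
      show "integrable lborel (\<lambda>x. ?g (t, x))"
        unfolding split
        by (rule integrableI_bounded_set_indicator[where B="norm (char M t)"])
           (use assms(1) in \<open>auto simp: norm_mult\<close>)
    qed
  qed measurable
  have "complex_of_real (measure M {a<..b}) =
      (CLINT t|lborel. (iexp (- (t * a)) - iexp (- (t * b))) / (\<i> * t) * char M t) / (2 * pi)"
    by (rule Levy_Inversion_integrable[OF assms])
  also have "(CLINT t|lborel. (iexp (- (t * a)) - iexp (- (t * b))) / (\<i> * t) * char M t)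
      = (CLINT t|lborel. CLINT x|lborel. ?g (t, x))"
  proof (rule integral_cong_AE)
    have "(iexp (- (t * a)) - iexp (- (t * b))) / (\<i> * t) * char M t = (CLINT x|lborel. ?g (t, x))"
      if "t \<noteq> 0" for t
    proof -
      have "(CLINT x|lborel. ?g (t, x)) = (CLINT x|lborel. (indicator {a<..b} x *\<^sub>R iexp (- (t * x))) * char M t)"
        by (simp only: split mult_scaleR_left)
      also have "\<dots> = (CLINT x:{a<..b}|lborel. iexp (- (t * x))) * char M t"
        unfolding set_lebesgue_integral_def by (rule integral_mult_left_zero)
      finally show ?thesis
        unfolding integral_iexp_Ioc[OF assms(1) that] ..
    qed
    then show "AE t in lborel. (iexp (- (t * a)) - iexp (- (t * b))) / (\<i> * t) * char M t
        = (CLINT x|lborel. ?g (t, x))"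
      by (intro AE_I[of _ _ "{0}"]) auto
  qed measurable
  also have "\<dots> = (CLINT x|lborel. CLINT t|lborel. ?g (t, x))"
    using lborel_pair.Fubini_integral[of "\<lambda>t x. ?g (t, x)"] g by simp
  also have "\<dots> / (2 * pi) = (CLINT x|lborel. (CLINT t|lborel. ?g (t, x)) / (2 * pi))"
    by (rule integral_divide_zero[symmetric])
  also have "\<dots> = (CLINT x:{a<..b}|lborel. inv_char M x)"
    by (simp add: set_lebesgue_integral_def inv_char_def)
  finally show ?thesis .
qed

lemma (in real_distribution) norm_inv_char_le:
  "norm (inv_char M x) \<le> (LINT t|lborel. norm (char M t)) / (2 * pi)"
  using integral_norm_bound[of lborel "\<lambda>t. iexp (- (t * x)) * char M t"]
  by (simp add: inv_char_def norm_divide norm_mult divide_right_mono)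

lemma (in real_distribution) isCont_inv_char:
  assumes int: "integrable lborel (char M)"
  shows "isCont (inv_char M) x"
  unfolding continuous_at_sequentially
proof (intro allI impI)
  fix u assume u: "u \<longlonglongrightarrow> x"
  have "(\<lambda>n. CLINT t|lborel. iexp (- (t * u n)) * char M t)
      \<longlonglongrightarrow> (CLINT t|lborel. iexp (- (t * x)) * char M t)"
  proof (rule integral_dominated_convergence)
    show "integrable lborel (\<lambda>t. norm (char M t))"
      using int by simp
    show "AE t in lborel. (\<lambda>n. iexp (- (t * u n)) * char M t) \<longlonglongrightarrow> iexp (- (t * x)) * char M t"
      using u by (intro AE_I2 tendsto_intros)
  qed (auto simp: norm_mult)
  then show "(inv_char M \<circ> u) \<longlonglongrightarrow> inv_char M x"
    unfolding inv_char_def comp_def by (intro tendsto_intros) auto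
qed

context real_distribution
begin

context
  assumes int: "integrable lborel (char M)"
begin

lemma inv_char_measurable [measurable]: "inv_char M \<in> borel_measurable borel"
  using isCont_inv_char[OF int]
  by (intro borel_measurable_continuous_onI) (simp add: continuous_at_imp_continuous_on)

lemma integrable_Ioc_inv_char:
  "integrable lborel (\<lambda>x. indicator {a<..b} x *\<^sub>R inv_char M x)" if "a \<le> b" for a b :: real
  using norm_inv_char_le that
  by (intro integrableI_bounded_set_indicator[where B="(LINT t|lborel. norm (char M t)) / (2 * pi)"]) auto

text \<open>
  The candidate density is bounded by some \<open>C\<close>, so an interval whose endpoints are no atoms has
  measure at most \<open>C\<close> times its length. There are only countably many atoms, so such intervals
  shrink to any given point. This removes the endpoint condition of the inversion formula.
\<close>

lemma measure_singleton_eq_0: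
  "measure M {x} = 0"
proof (rule ccontr)
  assume "measure M {x} \<noteq> 0"
  then have pos: "measure M {x} > 0"
    by (simp add: zero_less_measure_iff)
  define C where "C = (LINT t|lborel. norm (char M t)) / (2 * pi)"
  have "C \<ge> 0"
    by (simp add: C_def)
  \<comment> \<open>\<open>C + 1\<close> instead of \<open>C\<close> guards against division by zero; \<open>(a, b]\<close> will be shorter than \<open>2 \<delta>\<close>\<close>
  define \<delta> where "\<delta> = measure M {x} / (2 * (C + 1))"
  have "\<delta> > 0"
    using pos \<open>C \<ge> 0\<close> by (simp add: \<delta>_def)
  obtain a where a: "x - \<delta> < a" "a < x" "measure M {a} = 0"
    using real_interval_avoid_countable_set[OF _ countable_support, of "x - \<delta>" x] \<open>\<delta> > 0\<close> by auto
  obtain b where b: "x < b" "b < x + \<delta>" "measure M {b} = 0"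
    using real_interval_avoid_countable_set[OF _ countable_support, of x "x + \<delta>"] \<open>\<delta> > 0\<close> by auto
  have "measure M {x} \<le> measure M {a<..b}"
    using a b by (intro finite_measure_mono) auto
  also have "\<dots> = norm (complex_of_real (measure M {a<..b}))"
    by simp
  also have "\<dots> = norm (CLINT x|lborel. indicator {a<..b} x *\<^sub>R inv_char M x)"
    using measure_Ioc_if_null_endpoints[OF _ a(3) b(3) int] a b
    by (simp add: set_lebesgue_integral_def)
  also have "\<dots> \<le> (LINT x|lborel. indicator {a<..b} x * C)"
  proof (rule Bochner_Integration.integral_norm_bound_integral)
    show "integrable lborel (\<lambda>x. indicator {a<..b} x *\<^sub>R inv_char M x)"
      using a b by (intro integrable_Ioc_inv_char) simp
    show "integrable lborel (\<lambda>x. indicator {a<..b} x * C)"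
      using a b by simp
  qed (use norm_inv_char_le in \<open>auto simp: indicator_def C_def\<close>)
  also have "\<dots> = (b - a) * C"
    using a b by simp
  also have "\<dots> \<le> (b - a) * (C + 1)"
    using a b by (simp add: mult_left_mono)
  also have "\<dots> < (2 * \<delta>) * (C + 1)"
    using a b \<open>C \<ge> 0\<close> by (intro mult_strict_right_mono) auto
  also have "\<dots> = measure M {x}"
    using \<open>C \<ge> 0\<close> by (simp add: \<delta>_def field_simps)
  finally show False by simp
qed

lemma measure_Ioc_eq_integral_inv_char:
  fixes a b :: real
  assumes "a \<le> b"
  shows "measure M {a<..b} = (LINT x|lborel. indicator {a<..b} x * Re (inv_char M x))"
proof -
  have "measure M {a<..b} = Re (CLINT x|lborel. indicator {a<..b} x *\<^sub>R inv_char M x)"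
    using arg_cong[OF measure_Ioc_if_null_endpoints[OF assms measure_singleton_eq_0
        measure_singleton_eq_0 int], of Re]
    by (simp add: set_lebesgue_integral_def)
  also have "\<dots> = (LINT x|lborel. indicator {a<..b} x * Re (inv_char M x))"
    using integral_Re[OF integrable_Ioc_inv_char[OF assms]] by simp
  finally show ?thesis .
qed

text \<open>
  By continuity a negative value would persist on an interval, which would then have negative
  measure.
\<close>

lemma Re_inv_char_nonneg: "Re (inv_char M x) \<ge> 0"
proof (rule ccontr)
  let ?p = "\<lambda>y. Re (inv_char M y)"
  assume neg: "\<not> ?p x \<ge> 0"
  have "isCont ?p x"
    using isCont_inv_char[OF int] by (rule isCont_Re)
  then obtain d where "d > 0" and d: "\<And>y. \<bar>y - x\<bar> < d \<Longrightarrow> \<bar>?p y - ?p x\<bar> < - ?p x / 2"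
    using neg unfolding continuous_at_eps_delta dist_real_def
    by (metis half_gt_zero neg_0_less_iff_less not_le)
  have "0 \<le> measure M {x<..x + d/2}"
    by simp
  also have "\<dots> = (LINT y|lborel. indicator {x<..x + d/2} y * ?p y)"
    using \<open>d > 0\<close> by (simp add: measure_Ioc_eq_integral_inv_char)
  also have "\<dots> \<le> (LINT y|lborel. indicator {x<..x + d/2} y * (?p x / 2))"
  proof (rule integral_mono)
    show "integrable lborel (\<lambda>y. indicator {x<..x + d/2} y * ?p y)"
      using integrable_Re[OF integrable_Ioc_inv_char, of x "x + d/2"] \<open>d > 0\<close> by simp
    show "integrable lborel (\<lambda>y. indicator {x<..x + d/2} y * (?p x / 2))"
      using \<open>d > 0\<close> by simp
    fix y
    show "indicator {x<..x + d/2} y * ?p y \<le> indicator {x<..x + d/2} y * (?p x / 2)"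
      using d[of y] \<open>d > 0\<close> by (auto simp: indicator_def abs_if split: if_splits)
  qed
  also have "\<dots> = d / 2 * (?p x / 2)"
    using \<open>d > 0\<close> by simp
  also have "\<dots> < 0"
    using neg \<open>d > 0\<close> by (simp add: mult_pos_neg)
  finally show False by simp
qed

lemma eq_density_inv_char: "M = density lborel (\<lambda>x. ennreal (Re (inv_char M x)))"
proof (rule measure_eqI_generator_eq)
  let ?E = "range (\<lambda>(a, b). {a<..b::real})"
  let ?A = "\<lambda>n::nat. {- real n<..real n}"
  show "Int_stable ?E"
  proof (rule Int_stableI)
    fix S T assume "S \<in> ?E" "T \<in> ?E"
    then obtain a b c d where "S = {a<..b}" "T = {c<..d}" by auto
    then have "S \<inter> T = (\<lambda>(a, b). {a<..b}) (max a c, min b d)" by auto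
    then show "S \<inter> T \<in> ?E" by (rule range_eqI)
  qed
  show "?E \<subseteq> Pow UNIV" by simp
  show "sets M = sigma_sets UNIV ?E"
    by (simp add: borel_sigma_sets_Ioc)
  show "sets (density lborel (\<lambda>x. ennreal (Re (inv_char M x)))) = sigma_sets UNIV ?E"
    by (simp add: borel_sigma_sets_Ioc)
  show "range ?A \<subseteq> ?E" by auto
  show "(\<Union>n. ?A n) = UNIV"
  proof (intro set_eqI iffI UNIV_I)
    fix x :: real
    obtain n where "\<bar>x\<bar> < real n"
      using reals_Archimedean2 by blast
    then show "x \<in> (\<Union>n. ?A n)" by (intro UN_I[of n]) auto
  qed
  show "emeasure M (?A n) \<noteq> \<infinity>" for n
    by simp
  fix S assume "S \<in> ?E"
  then obtain a b where S: "S = {a<..b}" by auto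
  show "emeasure M S = emeasure (density lborel (\<lambda>x. ennreal (Re (inv_char M x)))) S"
  proof (cases "a \<le> b")
    case True
    have "emeasure M S = ennreal (LINT x|lborel. indicator {a<..b} x * Re (inv_char M x))"
      by (simp add: S emeasure_eq_measure measure_Ioc_eq_integral_inv_char[OF True])
    also have "\<dots> = (\<integral>\<^sup>+x. ennreal (indicator {a<..b} x * Re (inv_char M x)) \<partial>lborel)"
      using integrable_Re[OF integrable_Ioc_inv_char[OF True]] Re_inv_char_nonneg
      by (intro nn_integral_eq_integral[symmetric]) auto
    also have "\<dots> = emeasure (density lborel (\<lambda>x. ennreal (Re (inv_char M x)))) S"
      using Re_inv_char_nonneg
      by (simp add: S emeasure_density ennreal_mult ennreal_indicator mult.commute)
    finally show ?thesis .
  qed (simp add: S)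
qed

end

corollary obtain_continuous_density:
  assumes "integrable lborel (char M)"
  obtains p :: "real \<Rightarrow> real"
  where "continuous_on UNIV p" and "\<And>x. 0 \<le> p x" and "M = density lborel (\<lambda>x. ennreal (p x))"
proof
  show "continuous_on UNIV (\<lambda>x. Re (inv_char M x))"
    using isCont_inv_char[OF assms]
    by (intro continuous_intros) (simp add: continuous_at_imp_continuous_on)
qed (rule Re_inv_char_nonneg[OF assms] eq_density_inv_char[OF assms])+

end

section \<open>Tilting, translation and the converse part\<close>

lemma density_distr_add:
  fixes f :: "real \<Rightarrow> ennreal"
  assumes [measurable]: "f \<in> borel_measurable borel"
  shows "distr (density lborel f) borel (\<lambda>x. x + h) = density lborel (\<lambda>x. f (x - h))"
proof -
  have "density lborel (\<lambda>x. f (x - h)) = density (distr lborel borel ((+) h)) (\<lambda>x. f (x - h))"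
    by (simp add: lborel_distr_plus)
  also have "\<dots> = distr (density lborel (\<lambda>x. f (h + x - h))) borel ((+) h)"
    by (rule density_distr) measurable
  finally show ?thesis
    by (simp add: add.commute[of h] fun_eq_iff[symmetric] cong: distr_cong)
qed

text \<open>
  Let \<open>\<mu>\<close> be the law of \<open>X\<close>. Periodicity of \<open>\<Psi>\<close> reads \<open>L(t + h) = exp(t h + h\<^sup>2 / 2) L(t)\<close>, which
  says that the tilted law \<open>exp(h x - h\<^sup>2 / 2) \<mu>(dx)\<close> and the law of \<open>X + h\<close> have the same moment
  generating function. Both are therefore equal, and comparing densities gives
  \<open>p(x) exp(h x - h\<^sup>2 / 2) = p(x - h)\<close> almost everywhere; as \<open>\<phi>\<close> satisfies the same functional
  equation, the quotient \<open>p / \<phi>\<close> is periodic. The integrability of the characteristic function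
  supplies a density, and one that is continuous, so that the equation holds at every point.
\<close>

lemma subgaussian_imp_periodic_class:
  assumes "prob_space M" and "subgaussian M X"
    and periodic: "periodic_fun_simple (\<lambda>t. laplace_transform M X t * exp (- t\<^sup>2 / 2)) h"
    and int: "integrable lborel (char (distr M borel X))"
  shows "X \<in> periodic_class h M"
proof -
  interpret prob_space M by fact
  have [measurable]: "X \<in> borel_measurable M"
    using assms(2) by (simp add: subgaussian_def)
  interpret \<mu>: real_distribution "distr M borel X"
    by (rule real_distribution_distr) measurable
  define \<mu> where "\<mu> = distr M borel X"
  define L where "L = laplace_transform M X"
  define w where "w x = exp (h * x - h\<^sup>2 / 2)" for x
  have [measurable]: "w \<in> borel_measurable borel"
    unfolding w_def[abs_def] by measurable
  have L_shift: "L (t + h) = L t * exp (t * h + h\<^sup>2 / 2)" for t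
  proof -
    have "L (t + h) * exp (- (t + h)\<^sup>2 / 2) = L t * exp (- t\<^sup>2 / 2)"
      using periodic unfolding L_def periodic_fun_simple_def by blast
    then have "L (t + h) * exp (- (t + h)\<^sup>2 / 2) * exp ((t + h)\<^sup>2 / 2)
        = L t * exp (- t\<^sup>2 / 2) * exp ((t + h)\<^sup>2 / 2)"
      by simp
    then show ?thesis
      by (simp add: mult.assoc power2_sum add_divide_distrib diff_divide_distrib flip: exp_add)
  qed
  have exp_int: "integrable \<mu> (\<lambda>x. exp (t * x))" and L_eq: "(\<integral>x. exp (t * x) \<partial>\<mu>) = L t" for t
    using subgaussian_integrable_exp[OF assms(2)]
    by (simp_all add: \<mu>_def L_def laplace_transform_def integrable_distr_eq integral_distr)

  obtain p where p_cont: "continuous_on UNIV p" and p_nonneg: "\<And>x. 0 \<le> p x"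
    and \<mu>_p: "\<mu> = density lborel (\<lambda>x. ennreal (p x))"
    using \<mu>.obtain_continuous_density[OF int] unfolding \<mu>_def by metis
  have [measurable]: "p \<in> borel_measurable borel"
    using p_cont by (rule borel_measurable_continuous_onI)

  define \<tau> \<sigma> where "\<tau> = density \<mu> (\<lambda>x. ennreal (w x))" and "\<sigma> = distr \<mu> borel (\<lambda>x. x + h)"
  have [measurable_cong, simp]: "sets \<mu> = sets borel"
    by (simp add: \<mu>_def)
  have w_exp: "w x * exp (t * x) = exp (- h\<^sup>2 / 2) * exp ((t + h) * x)" for t x
    by (simp add: w_def algebra_simps flip: exp_add)
  have w_nonneg: "0 \<le> w x" for x
    by (simp add: w_def)
  have \<tau>_int: "integrable \<tau> (\<lambda>x. exp (t * x))" for t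
    unfolding \<tau>_def using exp_int[of "t + h"]
    by (subst integrable_density) (simp_all add: w_nonneg w_exp)
  have \<tau>_mgf: "(\<integral>x. exp (t * x) \<partial>\<tau>) = exp (t * h) * L t" for t
  proof -
    have "(\<integral>x. exp (t * x) \<partial>\<tau>) = exp (- h\<^sup>2 / 2) * L (t + h)"
      unfolding \<tau>_def by (subst integral_density) (simp_all add: w_nonneg w_exp L_eq)
    then show ?thesis
      by (simp add: L_shift exp_add exp_minus)
  qed
  have shift_exp: "exp (t * (x + h)) = exp (t * h) * exp (t * x)" for t x
    by (simp add: algebra_simps flip: exp_add)
  have \<sigma>_int: "integrable \<sigma> (\<lambda>x. exp (t * x))" for t
    unfolding \<sigma>_def using exp_int[of t] by (subst integrable_distr_eq) (simp_all add: shift_exp)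
  have \<sigma>_mgf: "(\<integral>x. exp (t * x) \<partial>\<sigma>) = exp (t * h) * L t" for t
    unfolding \<sigma>_def by (subst integral_distr) (simp_all add: shift_exp L_eq)
  have "\<tau> = \<sigma>"
  proof (rule mgf_uniqueness)
    \<comment> \<open>the total mass of \<open>\<tau>\<close> is its moment generating function at \<open>0\<close>\<close>
    have "emeasure \<tau> (space \<tau>) = (\<integral>\<^sup>+x. ennreal (exp (0 * x)) \<partial>\<tau>)"
      by simp
    also have "\<dots> = ennreal (\<integral>x. exp (0 * x) \<partial>\<tau>)"
      by (rule nn_integral_eq_integral) (use \<tau>_int[of 0] in auto)
    also have "\<dots> = 1"
      using L_eq[of 0] \<mu>.prob_space by (simp only: \<tau>_mgf) (simp add: \<mu>_def)
    finally have "prob_space \<tau>"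
      by (rule prob_spaceI)
    then show "real_distribution \<tau>"
      by (simp add: real_distribution_def real_distribution_axioms_def \<tau>_def)
    show "real_distribution \<sigma>"
      unfolding \<sigma>_def \<mu>_def by (rule \<mu>.real_distribution_distr) measurable
  qed (simp_all add: \<tau>_int \<sigma>_int \<tau>_mgf \<sigma>_mgf)
  moreover have "\<tau> = density lborel (\<lambda>x. ennreal (p x) * ennreal (w x))"
    unfolding \<tau>_def \<mu>_p by (rule density_density_eq) measurable
  moreover have "\<sigma> = density lborel (\<lambda>x. ennreal (p (x - h)))"
    unfolding \<sigma>_def \<mu>_p by (rule density_distr_add) measurable
  ultimately have "AE x in lborel. ennreal (p x) * ennreal (w x) = ennreal (p (x - h))"
    by (subst sigma_finite_measure.density_unique_iff[OF sigma_finite_lborel, symmetric]) simp_all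
  then have "AE x in lborel. p x * w x = p (x - h)"
    by eventually_elim (simp add: p_nonneg w_nonneg flip: ennreal_mult)
  then have "AE x in lebesgue. x \<in> {x. p x * w x = p (x - h)}"
    by (simp add: AE_completion)
  moreover have "closed {x. p x * w x = p (x - h)}"
    unfolding w_def
    by (intro closed_Collect_eq continuous_intros continuous_on_compose2[OF p_cont]) auto
  ultimately have p_shift: "p x * w x = p (x - h)" for x
    using mem_closed_if_AE_lebesgue[of _ x] by blast
  have "p (x + h) / std_normal_density (x + h) = p x / std_normal_density x" for x
  proof -
    have "w (x + h) * std_normal_density (x + h) = std_normal_density x"
      unfolding w_def exp_diff times_divide_eq_left std_normal_density_tilt by simp
    moreover have "p (x + h) * w (x + h) = p x"
      using p_shift[of "x + h"] by simp
    ultimately have "p x / std_normal_density x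
        = (w (x + h) * p (x + h)) / (w (x + h) * std_normal_density (x + h))"
      by (simp add: mult.commute)
    also have "\<dots> = p (x + h) / std_normal_density (x + h)"
      by (rule mult_divide_mult_cancel_left) (simp add: w_def)
    finally show ?thesis ..
  qed
  moreover have "distributed M lborel X (\<lambda>x. ennreal (p x))"
    using \<mu>_p by (simp add: distributed_def \<mu>_def cong: distr_cong)
  ultimately show "X \<in> periodic_class h M"
    using p_nonneg unfolding periodic_class_def periodic_fun_simple_def by blast
qed

theorem theorem1p6:
  fixes h :: real and M :: "'a measure" and X :: "'a \<Rightarrow> real"
  assumes "h > 0" and "prob_space M" and "X \<in> borel_measurable M"
  shows
    "(X \<in> periodic_class h M \<longrightarrow>
        subgaussian M X \<and>
        (\<exists>\<Psi> :: real \<Rightarrow> real. periodic_fun_simple \<Psi> h \<and>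
           (\<forall>t. laplace_transform M X t = \<Psi> t * exp (t\<^sup>2 / 2)))) \<and>
     (subgaussian M X \<and>
      periodic_fun_simple (\<lambda>t. laplace_transform M X t * exp (- t\<^sup>2 / 2)) h \<and>
      integrable lborel (char (distr M borel X)) \<longrightarrow>
        X \<in> periodic_class h M)"
  using periodic_class_imp_subgaussian[OF assms] subgaussian_imp_periodic_class[OF assms(2)]
  by blast

end
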